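(* Let $G$ be a factorizable graph, $M$ a perfect matching of $G$, and $u,v\in V(G)$ such that $G-u-v$ is not factorizable. If there is an $M$-balanced path from $u$ to $v$ and an $M$-balanced path from $v$ to $u$, then $u$ and $v$ lie in the same factor-component of $G$.
   Context: All graphs are finite. A graph is factorizable if it has a perfect matching. For factorizable $G$, an edge is allowed if it lies in some perfect matching; for each connected component $C$ of the subgraph formed by the allowed edges, the induced subgraph $G[V(C)]$ is a factor-component of $G$. For a matching $M$, a path $Q$ is $M$-alternating if $E(Q)\setminus M$ is a matching. An $M$-alternating path $P$ with ends $u,v$ is an $M$-balanced path from $u$ to $v$ if it has an even number of edges and $M\cap E(P)$ covers all vertices of $P$ except $v$ (a single-vertex path counts as such a path). *)

theory Defs
  imports Main
begin

text \<open>Finite undirected graphs, loops and parallel edges being permitted; a simple graph is the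
  special case in which all edges have two ends and \<open>ends\<close> is injective on the edges.\<close>

record ('v, 'e) ugraph =
  verts :: "'v set"
  edges :: "'e set"
  ends :: "'e \<Rightarrow> 'v set"

definition finite_graph :: "('v, 'e) ugraph \<Rightarrow> bool" where
  "finite_graph G \<longleftrightarrow> finite (verts G) \<and> finite (edges G) \<and>
     (\<forall>e\<in>edges G. ends G e \<subseteq> verts G \<and> (card (ends G e) = 1 \<or> card (ends G e) = 2))"

definition subgraph :: "('v, 'e) ugraph \<Rightarrow> ('v, 'e) ugraph \<Rightarrow> bool" where
  "subgraph H G \<longleftrightarrow> verts H \<subseteq> verts G \<and> edges H \<subseteq> edges G \<and> ends H = ends G \<and>
     (\<forall>e\<in>edges H. ends H e \<subseteq> verts H)"

definition induced :: "('v, 'e) ugraph \<Rightarrow> 'v set \<Rightarrow> ('v, 'e) ugraph" where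
  "induced G X = \<lparr>verts = verts G \<inter> X, edges = {e \<in> edges G. ends G e \<subseteq> X}, ends = ends G\<rparr>"

definition delete_verts :: "('v, 'e) ugraph \<Rightarrow> 'v set \<Rightarrow> ('v, 'e) ugraph" where
  "delete_verts G X = induced G (verts G - X)"

definition edge_subgraph :: "('v, 'e) ugraph \<Rightarrow> 'e set \<Rightarrow> ('v, 'e) ugraph" where
  "edge_subgraph G F = \<lparr>verts = (\<Union>e\<in>F. ends G e), edges = F, ends = ends G\<rparr>"

text \<open>A walk is given by its list of vertices and its list of edges.\<close>

definition is_walk :: "('v, 'e) ugraph \<Rightarrow> 'v list \<Rightarrow> 'e list \<Rightarrow> bool" where
  "is_walk G ps es \<longleftrightarrow> length ps = Suc (length es) \<and> set ps \<subseteq> verts G \<and> set es \<subseteq> edges G \<and>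
     (\<forall>i<length es. ends G (es ! i) = {ps ! i, ps ! Suc i})"

definition is_path :: "('v, 'e) ugraph \<Rightarrow> 'v list \<Rightarrow> 'e list \<Rightarrow> bool" where
  "is_path G ps es \<longleftrightarrow> is_walk G ps es \<and> distinct ps"

definition connected_graph :: "('v, 'e) ugraph \<Rightarrow> bool" where
  "connected_graph G \<longleftrightarrow> verts G \<noteq> {} \<and>
     (\<forall>x\<in>verts G. \<forall>y\<in>verts G. \<exists>ps es. is_path G ps es \<and> hd ps = x \<and> last ps = y)"

definition connected_component :: "('v, 'e) ugraph \<Rightarrow> ('v, 'e) ugraph \<Rightarrow> bool" where
  "connected_component G C \<longleftrightarrow> subgraph C G \<and> connected_graph C \<and>
     (\<forall>D. subgraph D G \<and> connected_graph D \<and> subgraph C D \<longrightarrow> D = C)"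

text \<open>Loops never belong to a matching.\<close>

definition matching :: "('v, 'e) ugraph \<Rightarrow> 'e set \<Rightarrow> bool" where
  "matching G M \<longleftrightarrow> M \<subseteq> edges G \<and> (\<forall>e\<in>M. card (ends G e) = 2) \<and>
     (\<forall>e\<in>M. \<forall>f\<in>M. e \<noteq> f \<longrightarrow> ends G e \<inter> ends G f = {})"

definition perfect_matching :: "('v, 'e) ugraph \<Rightarrow> 'e set \<Rightarrow> bool" where
  "perfect_matching G M \<longleftrightarrow> matching G M \<and> (\<Union>e\<in>M. ends G e) = verts G"

definition factorizable :: "('v, 'e) ugraph \<Rightarrow> bool" where
  "factorizable G \<longleftrightarrow> (\<exists>M. perfect_matching G M)"

definition allowed :: "('v, 'e) ugraph \<Rightarrow> 'e \<Rightarrow> bool" where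
  "allowed G e \<longleftrightarrow> (\<exists>M. perfect_matching G M \<and> e \<in> M)"

definition factor_component :: "('v, 'e) ugraph \<Rightarrow> ('v, 'e) ugraph \<Rightarrow> bool" where
  "factor_component G H \<longleftrightarrow>
     (\<exists>C. connected_component (edge_subgraph G {e \<in> edges G. allowed G e}) C \<and>
          H = induced G (verts C))"

definition alternating_path :: "('v, 'e) ugraph \<Rightarrow> 'e set \<Rightarrow> 'v list \<Rightarrow> 'e list \<Rightarrow> bool" where
  "alternating_path G M ps es \<longleftrightarrow> is_path G ps es \<and> matching G (set es - M)"

text \<open>The last equation includes that \<open>v\<close> itself is not covered; this already follows from parity
  when \<open>M\<close> is a matching.\<close>

definition balanced_path ::
  "('v, 'e) ugraph \<Rightarrow> 'e set \<Rightarrow> 'v \<Rightarrow> 'v \<Rightarrow> 'v list \<Rightarrow> 'e list \<Rightarrow> bool" where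
  "balanced_path G M u v ps es \<longleftrightarrow>
     alternating_path G M ps es \<and> hd ps = u \<and> last ps = v \<and> even (length es) \<and>
     (\<Union>e\<in>M \<inter> set es. ends G e) = set ps - {v}"

end

theory Submission
  imports Defs
begin

text \<open>Let \<open>P = p\<^sub>0 \<dots> p\<^sub>m\<close> be the balanced path from \<open>u\<close> to \<open>v\<close> and \<open>Q = q\<^sub>0 \<dots> q\<^sub>n\<close> the one from
  \<open>v\<close> to \<open>u\<close>. Suppose that \<open>p\<^sub>j = q\<^sub>k\<close> with \<open>j\<close>, \<open>k\<close> even, and that \<open>q\<^sub>0, \<dots>, q\<^sub>k\<close> avoid
  \<open>p\<^sub>0, \<dots>, p\<^sub>j\<^sub>-\<^sub>1\<close>; initially \<open>j = m\<close> and \<open>k = 0\<close>. If \<open>j > 0\<close>, let \<open>q\<^sub>k\<^sub>' = p\<^sub>j\<^sub>'\<close> be the first vertex of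
  \<open>Q\<close> among \<open>p\<^sub>0, \<dots>, p\<^sub>j\<^sub>-\<^sub>1\<close>. As these vertices are matched by \<open>M\<close> among themselves, \<open>Q\<close> enters
  \<open>p\<^sub>j\<^sub>'\<close> by an edge outside \<open>M\<close>. If \<open>j'\<close> is odd, then \<open>p\<^sub>0 \<dots> p\<^sub>j\<^sub>'\<close> followed by the reversal of
  \<open>q\<^sub>0 \<dots> q\<^sub>k\<^sub>'\<close> is an alternating path from \<open>u\<close> to \<open>v\<close> with both end edges in \<open>M\<close>, and flipping it
  yields a perfect matching of \<open>G - u - v\<close>. So \<open>j'\<close> is even, \<open>p\<^sub>j\<^sub>' \<dots> p\<^sub>j\<close> and \<open>q\<^sub>k \<dots> q\<^sub>k\<^sub>'\<close> form
  an alternating circuit, all of whose edges are allowed, and one continues with \<open>j'\<close>, \<open>k'\<close> until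
  \<open>u\<close> is reached.\<close>

section \<open>Exchanging the edges of a matching on a closed vertex set\<close>

text \<open>For \<open>M\<close> perfect and \<open>W\<close> inside the graph, this says that
  \<open>M\<close> splits into a perfect matching on \<open>W\<close> and one on the remaining
  vertices.\<close>

definition matching_closed :: "('v, 'e) ugraph \<Rightarrow> 'e set \<Rightarrow> 'v set \<Rightarrow> bool" where
  "matching_closed G M W \<longleftrightarrow> (\<forall>e\<in>M. ends G e \<inter> W \<noteq> {} \<longrightarrow> ends G e \<subseteq> W)"

text \<open>On a balanced path these are the edges outside \<open>M\<close> between positions
  \<open>a\<close> and \<open>b\<close>; parity of the index replaces reference to
  \<open>M\<close>.\<close>

definition odd_edges :: "'e list \<Rightarrow> nat \<Rightarrow> nat \<Rightarrow> 'e set" where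
  "odd_edges es a b = {es ! i |i. odd i \<and> a \<le> i \<and> i < b}"

lemma matching_closed_Un:
  "matching_closed G M A \<Longrightarrow> matching_closed G M B \<Longrightarrow> matching_closed G M (A \<union> B)"
  unfolding matching_closed_def by blast

text \<open>By closedness, dropping the edges of \<open>M\<close> that meet \<open>W\<close>
  uncovers exactly \<open>W\<close>, and \<open>N\<close> covers \<open>W - X\<close> again. With
  \<open>X = {u, v}\<close> this contradicts non-factorizability of the deleted graph; with
  \<open>X = {}\<close> it shows that the edges of \<open>N\<close> are allowed.\<close>

lemma perfect_matching_exchange:
  assumes M: "perfect_matching G M" and N: "matching G N"
    and W: "matching_closed G M W" "W \<subseteq> verts G"
    and cover: "(\<Union>e\<in>N. ends G e) = W - X" and X: "X \<subseteq> W"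
  shows "perfect_matching (delete_verts G X) ({e \<in> M. ends G e \<inter> W = {}} \<union> N)"
proof -
  let ?M = "{e \<in> M. ends G e \<inter> W = {}} \<union> N"
  have MG: "M \<subseteq> edges G" "\<forall>e\<in>M. card (ends G e) = 2" "(\<Union>e\<in>M. ends G e) = verts G"
    and Mdisj: "\<And>e f. e \<in> M \<Longrightarrow> f \<in> M \<Longrightarrow> e \<noteq> f \<Longrightarrow> ends G e \<inter> ends G f = {}"
    using M unfolding perfect_matching_def matching_def by blast+
  have NG: "N \<subseteq> edges G" "\<forall>e\<in>N. card (ends G e) = 2"
    and Ndisj: "\<And>e f. e \<in> N \<Longrightarrow> f \<in> N \<Longrightarrow> e \<noteq> f \<Longrightarrow> ends G e \<inter> ends G f = {}"
    using N unfolding matching_def by blast+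
  have NW: "ends G e \<subseteq> W - X" if "e \<in> N" for e
    using cover that by blast
  have "?M \<subseteq> {e \<in> edges G. ends G e \<subseteq> verts G - X}"
  proof (intro subsetI CollectI)
    fix e assume "e \<in> ?M"
    then show "e \<in> edges G \<and> ends G e \<subseteq> verts G - X"
    proof
      assume "e \<in> {e \<in> M. ends G e \<inter> W = {}}"
      then have "e \<in> M" "ends G e \<inter> W = {}" by simp_all
      moreover from \<open>e \<in> M\<close> have "ends G e \<subseteq> verts G" using MG(3) by blast
      ultimately show ?thesis using MG(1) X by blast
    next
      assume "e \<in> N"
      then show ?thesis using NG(1) NW W(2) by blast
    qed
  qed
  moreover have "\<forall>e\<in>?M. card (ends G e) = 2"
    using MG(2) NG(2) by blast
  moreover have "\<forall>e\<in>?M. \<forall>f\<in>?M. e \<noteq> f \<longrightarrow> ends G e \<inter> ends G f = {}"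
  proof (intro ballI impI)
    fix e f assume "e \<in> ?M" "f \<in> ?M" "e \<noteq> f"
    then show "ends G e \<inter> ends G f = {}"
      using Mdisj[of e f] Ndisj[of e f] NW[of e] NW[of f] by auto
  qed
  moreover have "(\<Union>e\<in>?M. ends G e) = verts G - X"
  proof (intro equalityI subsetI)
    fix x assume "x \<in> (\<Union>e\<in>?M. ends G e)"
    then show "x \<in> verts G - X"
      using MG(3) cover W(2) X by blast
  next
    fix x assume x: "x \<in> verts G - X"
    show "x \<in> (\<Union>e\<in>?M. ends G e)"
    proof (cases "x \<in> W")
      case True
      then show ?thesis using cover x by blast
    next
      case False
      obtain e where e: "e \<in> M" "x \<in> ends G e" using x MG(3) by blast
      then have "ends G e \<inter> W = {}"
        using W(1) False unfolding matching_closed_def by blast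
      then show ?thesis using e by blast
    qed
  qed
  ultimately show ?thesis
    unfolding perfect_matching_def matching_def delete_verts_def induced_def by auto
qed

lemma matching_Un:
  assumes "matching G A" "matching G B" "(\<Union>e\<in>A. ends G e) \<inter> (\<Union>e\<in>B. ends G e) = {}"
  shows "matching G (A \<union> B)"
proof -
  have "ends G e \<inter> ends G f = {}" "ends G f \<inter> ends G e = {}" if "e \<in> A" "f \<in> B" for e f
    using assms(3) that by blast+
  then show ?thesis
    using assms(1,2) unfolding matching_def by (simp add: ball_Un)
qed

section \<open>Paths and their edges of odd index\<close>

lemma path_ends:
  assumes "is_path G ps es" "i < length es"
  shows "ends G (es ! i) = {ps ! i, ps ! Suc i}" "ps ! i \<noteq> ps ! Suc i" "es ! i \<in> edges G"
    "length ps = Suc (length es)"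
  using assms unfolding is_path_def is_walk_def by (auto simp: nth_eq_iff_index_eq)

lemma path_nth_eq:
  assumes "is_path G ps es" "i \<le> length es" "j \<le> length es"
  shows "ps ! i = ps ! j \<longleftrightarrow> i = j"
  using assms unfolding is_path_def is_walk_def by (auto simp: nth_eq_iff_index_eq)

lemma path_nth_verts:
  assumes "is_path G ps es" "i \<le> length es"
  shows "ps ! i \<in> verts G"
  using assms nth_mem[of i ps] unfolding is_path_def is_walk_def by auto

lemma odd_edges_matching:
  assumes "is_path G ps es" "b \<le> length es"
  shows "matching G (odd_edges es a b)"
  unfolding matching_def
proof (intro conjI ballI impI)
  show "odd_edges es a b \<subseteq> edges G"
    using path_ends(3)[OF assms(1)] assms(2) unfolding odd_edges_def by fastforce
next
  fix e assume "e \<in> odd_edges es a b"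
  then obtain i where "e = es ! i" "i < b" unfolding odd_edges_def by blast
  then show "card (ends G e) = 2"
    using path_ends(1,2)[OF assms(1), of i] assms(2) by simp
next
  fix e f assume ef: "e \<in> odd_edges es a b" "f \<in> odd_edges es a b" "e \<noteq> f"
  then obtain i k where ik: "e = es ! i" "odd i" "i < b" "f = es ! k" "odd k" "k < b"
    unfolding odd_edges_def by blast
  with ef have "i \<noteq> k" "i \<noteq> Suc k" "Suc i \<noteq> k" by auto
  then show "ends G e \<inter> ends G f = {}"
    using ik assms path_ends(1)[OF assms(1)] by (auto simp: path_nth_eq[OF assms(1)])
qed

text \<open>A vertex of odd index starts an edge of odd index, and a vertex of even positive index
  ends one. Since \<open>a\<close> is even, \<open>ps ! a\<close> itself stays uncovered, hence the
  interval open on the left.\<close>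

lemma odd_edges_cover:
  assumes "is_path G ps es" "b \<le> length es" "even a" "even b"
  shows "(\<Union>e\<in>odd_edges es a b. ends G e) = (!) ps ` {a<..b}"
proof (intro equalityI subsetI)
  fix x assume "x \<in> (\<Union>e\<in>odd_edges es a b. ends G e)"
  then obtain i where i: "odd i" "a \<le> i" "i < b" "x \<in> ends G (es ! i)"
    unfolding odd_edges_def by blast
  moreover have "a \<noteq> i" using i(1) assms(3) by blast
  ultimately show "x \<in> (!) ps ` {a<..b}"
    using path_ends(1)[OF assms(1), of i] assms(2) by auto
next
  fix x assume "x \<in> (!) ps ` {a<..b}"
  then obtain i where i: "x = ps ! i" "a < i" "i \<le> b" by auto
  show "x \<in> (\<Union>e\<in>odd_edges es a b. ends G e)"
  proof (cases "odd i")
    case True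
    then have "i < b" using i(3) assms(4) by (metis le_neq_implies_less)
    then have "es ! i \<in> odd_edges es a b" "x \<in> ends G (es ! i)"
      using True i path_ends(1)[OF assms(1), of i] assms(2) unfolding odd_edges_def by auto
    then show ?thesis by blast
  next
    case False
    then obtain l where l: "i = Suc l" "odd l" using i(2) by (cases i) auto
    then have "es ! l \<in> odd_edges es a b" "x \<in> ends G (es ! l)"
      using i path_ends(1)[OF assms(1), of l] assms(2) unfolding odd_edges_def by auto
    then show ?thesis by blast
  qed
qed

section \<open>Alternation along balanced paths\<close>

text \<open>Each vertex except the last is covered by an edge of \<open>M\<close> on the path, which
  must be one of its at most two path edges. This forces the first edge into \<open>M\<close>;
  afterwards exactly one of two consecutive edges lies in \<open>M\<close>.\<close>

lemma balanced_path_edge_in_matching_iff: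
  assumes M: "perfect_matching G M" and P: "balanced_path G M u v ps es" and "i < length es"
  shows "es ! i \<in> M \<longleftrightarrow> even i"
proof -
  have path: "is_path G ps es"
    and cover: "(\<Union>e\<in>M \<inter> set es. ends G e) = set ps - {v}" and v: "last ps = v"
    using P unfolding balanced_path_def alternating_path_def by auto
  have len: "length ps = Suc (length es)"
    using path unfolding is_path_def is_walk_def by blast
  have vnth: "v = ps ! length es"
    using v len by (metis diff_Suc_1 last_conv_nth length_0_conv nat.distinct(1))
  have covered: "es ! i \<in> M \<or> 0 < i \<and> es ! (i - 1) \<in> M" if i: "i < length es" for i
  proof -
    have "ps ! i \<in> set ps - {v}"
      using i len path_nth_eq[OF path, of i "length es"] vnth by auto
    then obtain e where e: "e \<in> M" "e \<in> set es" "ps ! i \<in> ends G e" using cover by blast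
    then obtain k where k: "e = es ! k" "k < length es" by (metis in_set_conv_nth)
    then have "i = k \<or> i = Suc k"
      using e(3) i path_ends(1)[OF path k(2)] by (auto simp: path_nth_eq[OF path])
    then show ?thesis using e(1) k by auto
  qed
  show ?thesis using \<open>i < length es\<close>
  proof (induction i)
    case 0
    then show ?case using covered[of 0] by simp
  next
    case (Suc i)
    have e: "ends G (es ! i) = {ps ! i, ps ! Suc i}"
      "ends G (es ! Suc i) = {ps ! Suc i, ps ! Suc (Suc i)}"
      using path_ends(1)[OF path] Suc.prems by auto
    moreover have "ps ! i \<noteq> ps ! Suc (Suc i)" "ps ! i \<noteq> ps ! Suc i"
      using path_nth_eq[OF path] Suc.prems by auto
    ultimately have ne: "es ! i \<noteq> es ! Suc i" by auto
    have "\<not> (es ! i \<in> M \<and> es ! Suc i \<in> M)"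
      using ne e M unfolding perfect_matching_def matching_def by blast
    then show ?case
      using Suc covered[OF Suc.prems] by auto
  qed
qed

text \<open>For even \<open>a\<close> and \<open>b\<close>, the positions from \<open>a\<close> to
  \<open>b - 1\<close> fall into pairs \<open>l\<close>, \<open>Suc l\<close> with \<open>l\<close>
  even, each joined by the edge \<open>es ! l\<close> of \<open>M\<close>.\<close>

lemma balanced_path_segment_closed:
  assumes M: "perfect_matching G M" and P: "balanced_path G M u v ps es"
    and ab: "b \<le> length es" "even a" "even b"
  shows "matching_closed G M ((!) ps ` {a..<b})"
  unfolding matching_closed_def
proof (intro ballI impI)
  have path: "is_path G ps es"
    using P unfolding balanced_path_def alternating_path_def by auto
  fix e assume e: "e \<in> M" "ends G e \<inter> (!) ps ` {a..<b} \<noteq> {}"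
  then obtain i where i: "ps ! i \<in> ends G e" "a \<le> i" "i < b" by auto
  define l where "l = 2 * (i div 2)"
  have l: "even l" "a \<le> l" "Suc l < b" "i = l \<or> i = Suc l"
    using i ab unfolding l_def by presburger+
  then have "es ! l \<in> M"
    using balanced_path_edge_in_matching_iff[OF M P, of l] ab by auto
  moreover have ends: "ends G (es ! l) = {ps ! l, ps ! Suc l}"
    using path_ends(1)[OF path, of l] l ab by auto
  ultimately have "e = es ! l"
    using e(1) i(1) l(4) M unfolding perfect_matching_def matching_def by blast
  then show "ends G e \<subseteq> (!) ps ` {a..<b}" using ends l by auto
qed

section \<open>Linking the two ends by allowed edges\<close>

definition allowed_adj :: "('v, 'e) ugraph \<Rightarrow> ('v \<times> 'v) set" where
  "allowed_adj G = {(x, y). \<exists>e\<in>edges G. allowed G e \<and> ends G e = {x, y}}"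

lemma sym_allowed_adj: "sym (allowed_adj G)"
  unfolding sym_def allowed_adj_def by (auto simp: insert_commute)

lemma rtrancl_index:
  assumes "\<And>i. a \<le> i \<Longrightarrow> i < b \<Longrightarrow> (f i, f (Suc i)) \<in> R" "a \<le> b"
  shows "(f a, f b) \<in> R\<^sup>*"
  using assms(2,1) by (induction b rule: dec_induct) (auto intro: rtrancl_into_rtrancl)

lemma delete_verts_empty:
  assumes "finite_graph G"
  shows "delete_verts G {} = G"
  using assms unfolding delete_verts_def induced_def finite_graph_def
  by (intro ugraph.equality) auto

lemma balanced_paths_allowed_connected:
  assumes G: "finite_graph G" and M: "perfect_matching G M"
    and nonfac: "\<not> factorizable (delete_verts G {u, v})"
    and P: "balanced_path G M u v ps es" and Q: "balanced_path G M v u qs fs"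
  shows "(u, v) \<in> (allowed_adj G)\<^sup>*"
proof -
  have pathP: "is_path G ps es" and pathQ: "is_path G qs fs"
    and P': "hd ps = u" "last ps = v" "even (length es)"
    and Q': "hd qs = v" "last qs = u"
    using P Q unfolding balanced_path_def alternating_path_def by auto
  have len: "length ps = Suc (length es)" "length qs = Suc (length fs)"
    using pathP pathQ unfolding is_path_def is_walk_def by blast+
  have ends: "ps ! 0 = u" "ps ! length es = v" "qs ! 0 = v" "qs ! length fs = u"
    using P' Q' len hd_conv_nth[of ps] hd_conv_nth[of qs] last_conv_nth[of ps] last_conv_nth[of qs]
    by fastforce+
  have Medge: "M \<subseteq> edges G"
    using M unfolding perfect_matching_def matching_def by blast
  \<comment> \<open>The common vertex \<open>ps ! j = qs ! k\<close> is left out of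
    \<open>{0..<j}\<close> but included in \<open>{0..k}\<close>, so the disjointness condition is
    consistent with it.\<close>
  have step: "(u, ps ! j) \<in> (allowed_adj G)\<^sup>*"
    if "j \<le> length es" "k \<le> length fs" "even j" "even k" "ps ! j = qs ! k"
      "(!) ps ` {0..<j} \<inter> (!) qs ` {0..k} = {}" for j k
    using that
  proof (induction j arbitrary: k rule: less_induct)
    case (less j)
    note jk = less.prems
    show ?case
    proof (cases "j = 0")
      case True
      then show ?thesis using ends by simp
    next
      case False
      define k' where "k' = (LEAST i. i \<le> length fs \<and> qs ! i \<in> (!) ps ` {0..<j})"
      \<comment> \<open>The least index exists because \<open>qs\<close> ends at
        \<open>u = ps ! 0\<close>, which belongs to the segment as \<open>j\<close> is
        positive.\<close>
      have "ps ! 0 \<in> (!) ps ` {0..<j}"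
        using False by (intro imageI) simp
      then have "length fs \<le> length fs \<and> qs ! length fs \<in> (!) ps ` {0..<j}"
        using ends(1,4) by simp
      from LeastI[of "\<lambda>i. i \<le> length fs \<and> qs ! i \<in> (!) ps ` {0..<j}", OF this]
      have k': "k' \<le> length fs" "qs ! k' \<in> (!) ps ` {0..<j}"
        unfolding k'_def by blast+
      have least: "qs ! i \<notin> (!) ps ` {0..<j}" if "i < k'" for i
        using not_less_Least[OF that[unfolded k'_def]] that k'(1) by auto
      have kk': "k < k'"
      proof (rule ccontr)
        assume "\<not> k < k'"
        then have "qs ! k' \<in> (!) qs ` {0..k}" by simp
        then show False using k'(2) jk(6) by blast
      qed
      have closedP: "matching_closed G M ((!) ps ` {0..<j})"
        using balanced_path_segment_closed[OF M P jk(1)] jk(3) by simp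
      \<comment> \<open>Otherwise the edge entering \<open>qs ! k'\<close> lies in \<open>M\<close>,
        and closedness puts the preceding vertex of \<open>qs\<close> into the segment, against
        minimality of \<open>k'\<close>.\<close>
      have "even k'"
      proof (rule ccontr)
        assume "odd k'"
        then obtain l where l: "k' = Suc l" "even l" by (cases k') auto
        then have "fs ! l \<in> M" "ends G (fs ! l) = {qs ! l, qs ! k'}"
          using balanced_path_edge_in_matching_iff[OF M Q, of l] path_ends(1)[OF pathQ, of l] k'(1)
          by auto
        then have "qs ! l \<in> (!) ps ` {0..<j}"
          using closedP k'(2) unfolding matching_closed_def by blast
        then show False using least[of l] l by simp
      qed
      obtain j' where j': "j' < j" "qs ! k' = ps ! j'" using k'(2) by auto
      have Qavoid: "ps ! a \<noteq> qs ! i" if "i < k'" "a < j" for i a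
        using least[OF that(1)] that(2) by (metis atLeastLessThan_iff imageI zero_le)
      have "even j'"
      proof (rule ccontr)
        assume "odd j'"
        \<comment> \<open>The common vertex \<open>ps ! j' = qs ! k'\<close> is covered from the
          side of \<open>qs\<close>, so the edges on \<open>ps\<close> stop at the even position
          \<open>j' - 1\<close>. Within \<open>?W\<close> only the starting vertices
          \<open>u\<close> and \<open>v\<close> remain uncovered. The segment of \<open>ps\<close>
          in \<open>?W\<close> is closed since \<open>Suc j'\<close> is even.\<close>
        let ?N = "odd_edges es 0 (j' - 1) \<union> odd_edges fs 0 k'"
        let ?W = "(!) ps ` {0..<Suc j'} \<union> (!) qs ` {0..<k'}"
        have coverP: "(\<Union>e\<in>odd_edges es 0 (j' - 1). ends G e) = (!) ps ` {0<..j' - 1}"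
          using odd_edges_cover[OF pathP, of "j' - 1" 0] \<open>odd j'\<close> j' jk(1) by simp
        have coverQ: "(\<Union>e\<in>odd_edges fs 0 k'. ends G e) = (!) qs ` {0<..k'}"
          using odd_edges_cover[OF pathQ k'(1), of 0] \<open>even k'\<close> by simp
        have j'0: "0 < j'" using \<open>odd j'\<close> by (cases j') auto
        have disj: "ps ! a \<noteq> qs ! i" if "i \<le> k'" "a < j'" for i a
        proof (cases "i = k'")
          case True
          then show ?thesis using j' that jk(1) path_nth_eq[OF pathP, of a j'] by auto
        next
          case False
          then show ?thesis using Qavoid that j'(1) by auto
        qed
        have "matching G ?N"
        proof (rule matching_Un)
          show "matching G (odd_edges es 0 (j' - 1))" "matching G (odd_edges fs 0 k')"
            using odd_edges_matching[OF pathP] odd_edges_matching[OF pathQ] k'(1) j'(1) jk(1) by auto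
          show "(\<Union>e\<in>odd_edges es 0 (j' - 1). ends G e) \<inter> (\<Union>e\<in>odd_edges fs 0 k'. ends G e) = {}"
            unfolding coverP coverQ using disj j'0 by fastforce
        qed
        moreover have "matching_closed G M ?W"
          using balanced_path_segment_closed[OF M P, of "Suc j'" 0]
            balanced_path_segment_closed[OF M Q, of k' 0] \<open>odd j'\<close> \<open>even k'\<close> j' jk(1) k'
          by (intro matching_closed_Un) auto
        moreover have "?W \<subseteq> verts G"
          using path_nth_verts[OF pathP] path_nth_verts[OF pathQ] j'(1) jk(1) k'(1) by auto
        moreover have "{u, v} \<subseteq> ?W"
          using ends kk' by force
        moreover have "(\<Union>e\<in>?N. ends G e) = ?W - {u, v}"
        proof -
          have "{0..<Suc j'} = insert 0 (insert j' {0<..j' - 1})" using j'0 by auto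
          then have P: "(!) ps ` {0..<Suc j'} = {ps ! 0, qs ! k'} \<union> (!) ps ` {0<..j' - 1}"
            unfolding j'(2) by simp
          have "{0..<k'} = insert 0 {0<..<k'}" "{0<..k'} = insert k' {0<..<k'}"
            using kk' by auto
          then have Q: "(!) qs ` {0..<k'} = {qs ! 0} \<union> (!) qs ` {0<..<k'}"
            "(!) qs ` {0<..k'} = {qs ! k'} \<union> (!) qs ` {0<..<k'}"
            by simp_all
          have fresh: "ps ! 0 \<notin> (!) ps ` {0<..j' - 1}" "qs ! 0 \<notin> (!) qs ` {0<..k'}"
            using j'(1) jk(1) k'(1) by (auto simp: path_nth_eq[OF pathP] path_nth_eq[OF pathQ])
          have fresh': "ps ! 0 \<notin> (!) qs ` {0<..k'}"
            using disj[of _ 0] j'0 by fastforce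
          have fresh'': "qs ! 0 \<notin> (!) ps ` {0<..j' - 1}"
          proof
            assume "qs ! 0 \<in> (!) ps ` {0<..j' - 1}"
            then obtain a where "qs ! 0 = ps ! a" "a < j'" using j'0 by auto
            then show False using disj[of 0 a] by simp
          qed
          \<comment> \<open>Pure set algebra, with \<open>p\<close> as \<open>u\<close>,
            \<open>q\<close> as \<open>v\<close> and \<open>r\<close> as the common vertex
            \<open>qs ! k'\<close>.\<close>
          have "A \<union> Q' = P \<union> Q - {p, q}"
            if "P = {p, r} \<union> A" "Q = {q} \<union> B" "Q' = {r} \<union> B" "p \<notin> A" "q \<notin> Q'" "p \<notin> Q'" "q \<notin> A"
            for A B P Q Q' :: "'a set" and p q r
            using that by blast
          from this[OF P Q fresh fresh' fresh''] show ?thesis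
            unfolding UN_Un coverP coverQ ends(1,3) .
        qed
        ultimately have "factorizable (delete_verts G {u, v})"
          using perfect_matching_exchange[OF M, of ?N ?W "{u, v}"] unfolding factorizable_def
          by (intro exI)
        then show False using nonfac by blast
      qed
      \<comment> \<open>Now the two segments form a circuit. The edges of \<open>?N\<close> cover
        the intervals open on the left, while \<open>?W\<close> consists of those open on the right;
        the unions agree because \<open>ps ! j = qs ! k\<close> and \<open>ps ! j' = qs ! k'\<close>
        merely change sides.\<close>
      let ?N = "odd_edges es j' j \<union> odd_edges fs k k'"
      let ?W = "(!) ps ` {j'..<j} \<union> (!) qs ` {k..<k'}"
      have coverP: "(\<Union>e\<in>odd_edges es j' j. ends G e) = (!) ps ` {j'<..j}"
        using odd_edges_cover[OF pathP jk(1)] jk(3) \<open>even j'\<close> by simp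
      have coverQ: "(\<Union>e\<in>odd_edges fs k k'. ends G e) = (!) qs ` {k<..k'}"
        using odd_edges_cover[OF pathQ k'(1)] \<open>even k'\<close> jk(4) by simp
      have disj: "ps ! a \<noteq> qs ! i" if ai: "k < i" "i \<le> k'" "j' < a" "a \<le> j" for i a
      proof -
        consider "i = k'" | "a = j" | "i < k'" "a < j" using ai(2,4) le_neq_implies_less by blast
        then show ?thesis
        proof cases
          case 1
          then show ?thesis using j'(2) ai jk(1) path_nth_eq[OF pathP, of a j'] by auto
        next
          case 2
          then show ?thesis using jk(5) ai k'(1) path_nth_eq[OF pathQ, of k i] by auto
        next
          case 3
          then show ?thesis using Qavoid by blast
        qed
      qed
      have "matching G ?N"
      proof (rule matching_Un)
        show "matching G (odd_edges es j' j)" "matching G (odd_edges fs k k')"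
          using odd_edges_matching[OF pathP jk(1)] odd_edges_matching[OF pathQ k'(1)] by auto
        show "(\<Union>e\<in>odd_edges es j' j. ends G e) \<inter> (\<Union>e\<in>odd_edges fs k k'. ends G e) = {}"
          unfolding coverP coverQ using disj by fastforce
      qed
      moreover have "matching_closed G M ?W"
        using balanced_path_segment_closed[OF M P jk(1) \<open>even j'\<close> jk(3)]
          balanced_path_segment_closed[OF M Q k'(1) jk(4) \<open>even k'\<close>]
        by (rule matching_closed_Un)
      moreover have "?W \<subseteq> verts G"
        using path_nth_verts[OF pathP] path_nth_verts[OF pathQ] jk(1) k'(1) by auto
      moreover have "(\<Union>e\<in>?N. ends G e) = ?W - {}"
      proof -
        have "{j'..<j} = insert j' {j'<..<j}" "{j'<..j} = insert j {j'<..<j}"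
          "{k..<k'} = insert k {k<..<k'}" "{k<..k'} = insert k' {k<..<k'}"
          using j'(1) kk' by auto
        then have segments: "(!) ps ` {j'..<j} = {qs ! k'} \<union> (!) ps ` {j'<..<j}"
          "(!) ps ` {j'<..j} = {qs ! k} \<union> (!) ps ` {j'<..<j}"
          "(!) qs ` {k..<k'} = {qs ! k} \<union> (!) qs ` {k<..<k'}"
          "(!) qs ` {k<..k'} = {qs ! k'} \<union> (!) qs ` {k<..<k'}"
          using j'(2) jk(5) by simp_all
        show ?thesis
          unfolding UN_Un coverP coverQ segments by (simp only: Diff_empty Un_ac)
      qed
      ultimately have "perfect_matching (delete_verts G {}) ({e \<in> M. ends G e \<inter> ?W = {}} \<union> ?N)"
        by (rule perfect_matching_exchange[OF M _ _ _ _ empty_subsetI])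
      then have allowedN: "allowed G e" if "e \<in> ?N" for e
        using that unfolding allowed_def delete_verts_empty[OF G] by blast
      \<comment> \<open>Along \<open>ps\<close>, edges of even index are allowed through
        \<open>M\<close> itself, and those of odd index through the exchanged matching.\<close>
      have "(ps ! j', ps ! j) \<in> (allowed_adj G)\<^sup>*"
      proof (rule rtrancl_index)
        fix i assume i: "j' \<le> i" "i < j"
        have "allowed G (es ! i)"
        proof (cases "even i")
          case True
          then have "es ! i \<in> M"
            using balanced_path_edge_in_matching_iff[OF M P] i jk(1) by auto
          then show ?thesis using M unfolding allowed_def by blast
        next
          case False
          then have "es ! i \<in> ?N" using i unfolding odd_edges_def by blast
          then show ?thesis by (rule allowedN)
        qed
        then show "(ps ! i, ps ! Suc i) \<in> allowed_adj G"
          using path_ends[OF pathP, of i] i jk(1) unfolding allowed_adj_def by auto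
      qed (use j' in simp)
      moreover have "(!) ps ` {0..<j'} \<inter> (!) qs ` {0..k'} = {}"
      proof -
        have "ps ! a \<noteq> qs ! i" if "a < j'" "i \<le> k'" for a i
        proof (cases "i = k'")
          case True
          then show ?thesis using j' that jk(1) path_nth_eq[OF pathP, of a j'] by auto
        next
          case False
          then show ?thesis using Qavoid that j'(1) by auto
        qed
        then show ?thesis by auto
      qed
      then have "(u, ps ! j') \<in> (allowed_adj G)\<^sup>*"
        using less.IH[OF j'(1), of k'] j' k'(1) \<open>even j'\<close> \<open>even k'\<close> jk(1) by simp
      ultimately show ?thesis by simp
    qed
  qed
  have "(!) ps ` {0..<length es} \<inter> (!) qs ` {0..0} = {}"
  proof -
    have "ps ! a \<noteq> qs ! 0" if "a < length es" for a
      using path_nth_eq[OF pathP, of a "length es"] that ends(2,3) by auto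
    then show ?thesis by fastforce
  qed
  then show ?thesis
    using step[of "length es" 0] ends P' by simp
qed

section \<open>From reachability to factor-components\<close>

lemma path_snoc:
  assumes "is_path G ps es" "e \<in> edges G" "ends G e = {last ps, z}" "z \<in> verts G" "z \<notin> set ps"
  shows "is_path G (ps @ [z]) (es @ [e])"
proof -
  have len: "length ps = Suc (length es)"
    using assms(1) unfolding is_path_def is_walk_def by blast
  then have "last ps = ps ! length es" using last_conv_nth[of ps] by fastforce
  then show ?thesis
    using assms len unfolding is_path_def is_walk_def
    by (auto simp: nth_append less_Suc_eq)
qed

lemma path_take:
  assumes "is_path G ps es" "i \<le> length es"
  shows "is_path G (take (Suc i) ps) (take i es)" "hd (take (Suc i) ps) = hd ps"
    "last (take (Suc i) ps) = ps ! i"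
proof -
  have len: "length ps = Suc (length es)"
    using assms(1) unfolding is_path_def is_walk_def by blast
  show "is_path G (take (Suc i) ps) (take i es)"
    using assms len set_take_subset[of "Suc i" ps] set_take_subset[of i es]
    unfolding is_path_def is_walk_def by auto
  show "hd (take (Suc i) ps) = hd ps" by (cases ps) auto
  show "last (take (Suc i) ps) = ps ! i"
    using len assms(2) by (simp add: take_Suc_conv_app_nth)
qed

text \<open>Vertices must stay distinct: when the next vertex already lies on the path, the path is
  cut there; otherwise it is extended by one edge.\<close>

lemma path_if_rtrancl:
  assumes "(x, y) \<in> R\<^sup>*" "x \<in> verts H"
    and "\<And>y z. y \<in> verts H \<Longrightarrow> (y, z) \<in> R \<Longrightarrow> z \<in> verts H \<and> (\<exists>e\<in>edges H. ends H e = {y, z})"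
  shows "\<exists>ps es. is_path H ps es \<and> hd ps = x \<and> last ps = y"
  using assms(1)
proof (induction rule: rtrancl_induct)
  case base
  have "is_path H [x] []" using assms(2) unfolding is_path_def is_walk_def by simp
  then show ?case by fastforce
next
  case (step y z)
  then obtain ps es where P: "is_path H ps es" "hd ps = x" "last ps = y" by blast
  have len: "length ps = Suc (length es)" "set ps \<subseteq> verts H"
    using P(1) unfolding is_path_def is_walk_def by blast+
  show ?case
  proof (cases "z \<in> set ps")
    case True
    then obtain i where "i \<le> length es" "ps ! i = z"
      using len by (metis in_set_conv_nth less_Suc_eq_le)
    then show ?thesis using path_take[OF P(1)] P(2) by metis
  next
    case False
    have "y \<in> verts H" using P(3) len last_in_set[of ps] by fastforce
    then obtain e where "e \<in> edges H" "ends H e = {y, z}" "z \<in> verts H"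
      using assms(3) step(2) by blast
    then have "is_path H (ps @ [z]) (es @ [e])" using path_snoc P False by metis
    moreover have "hd (ps @ [z]) = x" using P(2) len by (cases ps) auto
    ultimately show ?thesis by fastforce
  qed
qed

text \<open>The vertices reachable from \<open>u\<close> by allowed edges, with all allowed edges
  among them, form a component of the allowed subgraph.\<close>

lemma factor_component_if_allowed_connected:
  assumes G: "finite_graph G" and M: "perfect_matching G M" and u: "u \<in> verts G"
    and uv: "(u, v) \<in> (allowed_adj G)\<^sup>*"
  shows "\<exists>H. factor_component G H \<and> u \<in> verts H \<and> v \<in> verts H"
proof -
  define A where "A = edge_subgraph G {e \<in> edges G. allowed G e}"
  define S where "S = {y. (u, y) \<in> (allowed_adj G)\<^sup>*}"
  define C where "C = \<lparr>verts = S, edges = {e \<in> edges A. ends G e \<subseteq> S}, ends = ends G\<rparr>"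
  have A: "verts A = (\<Union>e\<in>edges A. ends G e)" "edges A = {e \<in> edges G. allowed G e}"
    "ends A = ends G"
    unfolding A_def edge_subgraph_def by auto
  have C: "verts C = S" "edges C = {e \<in> edges A. ends G e \<subseteq> S}" "ends C = ends G"
    unfolding C_def by auto
  \<comment> \<open>\<open>edge_subgraph\<close> keeps only vertices covered by its edges; the edge
    of \<open>M\<close> at \<open>u\<close> is allowed and provides one.\<close>
  have uA: "u \<in> verts A"
  proof -
    obtain e where "e \<in> M" "u \<in> ends G e"
      using M u unfolding perfect_matching_def by blast
    moreover have "e \<in> edges G" "allowed G e"
      using M \<open>e \<in> M\<close> unfolding allowed_def perfect_matching_def matching_def by blast+
    ultimately show ?thesis unfolding A by blast
  qed
  have adjA: "x \<in> verts A \<and> y \<in> verts A" if "(x, y) \<in> allowed_adj G" for x y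
    using that unfolding allowed_adj_def A by blast
  have "(u, y) \<in> (allowed_adj G)\<^sup>* \<Longrightarrow> y \<in> verts A" for y
    by (induction rule: rtrancl_induct) (use uA adjA in auto)
  then have SA: "S \<subseteq> verts A" unfolding S_def by blast
  have adjC: "z \<in> verts C \<and> (\<exists>e\<in>edges C. ends C e = {y, z})"
    if yz: "y \<in> verts C" "(y, z) \<in> allowed_adj G" for y z
  proof -
    have "z \<in> S" using yz unfolding C S_def by (auto intro: rtrancl_into_rtrancl)
    then show ?thesis using yz unfolding C A allowed_adj_def by auto
  qed
  have "subgraph C A" using SA unfolding subgraph_def C A(3) by auto
  moreover have "connected_graph C"
    unfolding connected_graph_def
  proof (intro conjI ballI)
    show "verts C \<noteq> {}" unfolding C S_def by blast
    fix x y assume xy: "x \<in> verts C" "y \<in> verts C"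
    then have "(x, u) \<in> (allowed_adj G)\<^sup>*" "(u, y) \<in> (allowed_adj G)\<^sup>*"
      using symD[OF sym_rtrancl[OF sym_allowed_adj]] unfolding C S_def by auto
    then have "(x, y) \<in> (allowed_adj G)\<^sup>*" by simp
    then show "\<exists>ps es. is_path C ps es \<and> hd ps = x \<and> last ps = y"
      using path_if_rtrancl[OF _ xy(1)] adjC by metis
  qed
  \<comment> \<open>Maximality: a path in \<open>D\<close> from \<open>u\<close> uses allowed edges
    only, so it never leaves \<open>S\<close>, and \<open>C\<close> already has every allowed edge
    inside \<open>S\<close>.\<close>
  moreover have "D = C" if D: "subgraph D A" "connected_graph D" "subgraph C D" for D
  proof -
    have "u \<in> verts D" using D(3) unfolding subgraph_def C S_def by auto
    have "verts D \<subseteq> S"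
    proof
      fix y assume "y \<in> verts D"
      then obtain ps es where P: "is_path D ps es" "hd ps = u" "last ps = y"
        using D(2) \<open>u \<in> verts D\<close> unfolding connected_graph_def by blast
      have len: "length ps = Suc (length es)"
        using P(1) unfolding is_path_def is_walk_def by blast
      have "(ps ! 0, ps ! length es) \<in> (allowed_adj G)\<^sup>*"
      proof (rule rtrancl_index)
        fix i assume "i < length es"
        then have "es ! i \<in> edges A" "ends G (es ! i) = {ps ! i, ps ! Suc i}"
          using path_ends(1,3)[OF P(1), of i] D(1) A(3) unfolding subgraph_def by auto
        then show "(ps ! i, ps ! Suc i) \<in> allowed_adj G"
          unfolding allowed_adj_def A by blast
      qed simp
      moreover have "ps ! 0 = u" "ps ! length es = y"
        using P len hd_conv_nth[of ps] last_conv_nth[of ps] by fastforce+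
      ultimately show "y \<in> S" unfolding S_def by simp
    qed
    then have "verts D = verts C" "edges D = edges C" "ends D = ends C"
      using D(1,3) unfolding subgraph_def C A(3) by auto
    then show "D = C" by (intro ugraph.equality) auto
  qed
  ultimately have "connected_component A C" unfolding connected_component_def by blast
  then have "factor_component G (induced G S)"
    unfolding factor_component_def A_def[symmetric] using C(1) by metis
  moreover have "verts A \<subseteq> verts G"
    using G unfolding A finite_graph_def by auto
  then have "u \<in> verts (induced G S)" "v \<in> verts (induced G S)"
    using SA uv unfolding induced_def S_def by auto
  ultimately show ?thesis by blast
qed

theorem theorem7:
  fixes G :: "('v, 'e) ugraph" and M :: "'e set" and u v :: 'v
  assumes "finite_graph G"
    and "factorizable G"
    and "perfect_matching G M"
    and "u \<in> verts G" and "v \<in> verts G"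
    and "\<not> factorizable (delete_verts G {u, v})"
    and "\<exists>ps es. balanced_path G M u v ps es"
    and "\<exists>ps es. balanced_path G M v u ps es"
  shows "\<exists>H. factor_component G H \<and> u \<in> verts H \<and> v \<in> verts H"
  using balanced_paths_allowed_connected factor_component_if_allowed_connected assms by metis

end
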